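(* For every $n\ge2$ and every $p>1$ there exist $f_0,f_1\in\mathcal Q^n_0$ and $t\in(0,1)$ such that, setting $$f_t(z)=\sup\{f_0(x)^{1-t}f_1(y)^t:\ (1-t)x+ty=z\},\qquad z\in\mathbb R^n,$$ one has $$\int_{\mathbb R^n}|\nabla f_t(z)|^p\,dz<\Big(\int_{\mathbb R^n}|\nabla f_0(x)|^p\,dx\Big)^{1-t}\Big(\int_{\mathbb R^n}|\nabla f_1(y)|^p\,dy\Big)^{t}.$$
   Context: $\mathcal Q^n_0$ is the set of functions $f:\mathbb R^n\to[0,+\infty]$ that are not identically zero, log-concave ($f((1-\lambda)x+\lambda y)\ge f(x)^{1-\lambda}f(y)^\lambda$ for all $\lambda\in(0,1)$ and all $x,y$ with $f(x)f(y)>0$), upper semicontinuous, and satisfy $\lim_{\|x\|\to\infty}f(x)=0$. $\nabla$ is the gradient, which exists almost everywhere for finite-valued log-concave functions. *)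

theory Defs
  imports "HOL-Analysis.Analysis"
begin

(* Only meant for exponents r > 0, so that 0 powr r = 0 and \<infinity> powr r = \<infinity>. *)
definition ennpowr :: "ennreal \<Rightarrow> real \<Rightarrow> ennreal" (infixr "ennpowr" 80)
  where "a ennpowr r = (if a = \<infinity> then \<infinity> else ennreal (enn2real a powr r))"

definition log_concave_fun :: "('a::real_vector \<Rightarrow> ennreal) \<Rightarrow> bool"
  where "log_concave_fun f \<longleftrightarrow>
    (\<forall>l::real. \<forall>x y. 0 < l \<and> l < 1 \<and> 0 < f x * f y \<longrightarrow>
       f x ennpowr (1 - l) * f y ennpowr l \<le> f ((1 - l) *\<^sub>R x + l *\<^sub>R y))"

definition usc_fun :: "('a::topological_space \<Rightarrow> ennreal) \<Rightarrow> bool"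
  where "usc_fun f \<longleftrightarrow> (\<forall>x. Limsup (at x) f \<le> f x)"

definition Q0 :: "(real ^ 'n \<Rightarrow> ennreal) set"
  where "Q0 = {f. (\<exists>x. f x \<noteq> 0) \<and> log_concave_fun f \<and> usc_fun f \<and> (f \<longlongrightarrow> 0) at_infinity}"

definition sup_conv ::
    "real \<Rightarrow> ('a::real_vector \<Rightarrow> ennreal) \<Rightarrow> ('a \<Rightarrow> ennreal) \<Rightarrow> 'a \<Rightarrow> ennreal"
  where "sup_conv t f g z =
    Sup {f x ennpowr (1 - t) * g y ennpowr t | x y. (1 - t) *\<^sub>R x + t *\<^sub>R y = z}"

definition gradient :: "('a::real_inner \<Rightarrow> real) \<Rightarrow> 'a \<Rightarrow> 'a"
  where "gradient g x = (if \<exists>D. GDERIV g x :> D then (THE D. GDERIV g x :> D) else 0)"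

(* The integral of |grad f|^p, with values in [0,\<infinity>].  The gradient is set to 0 where it does
   not exist; for a finite-valued log-concave f this is a null set.  The truncation enn2real
   (sending \<infinity> to 0) matters only where f is infinite.  If f in Q0 attains \<infinity>, then
   log-concavity and upper semicontinuity force f to take only the values 0 and \<infinity>, hence
   grad_integral p f = 0. *)
definition grad_integral :: "real \<Rightarrow> (real ^ 'n \<Rightarrow> ennreal) \<Rightarrow> ennreal"
  where "grad_integral p f =
    (\<integral>\<^sup>+ x. ennreal (norm (gradient (\<lambda>y. enn2real (f y)) x) powr p) \<partial>lborel)"

end

theory Submission
  imports Defs
begin

text \<open>
  The inequality can fail because sup-convolution repairs the boundary behaviour of a function.
  Let \<open>f0\<close> be \<open>x\<^sub>k powr a\<close> on the unit cube and \<open>0\<close> outside, with \<open>0 < a < 1\<close>. Its gradient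
  blows up at the face \<open>x\<^sub>k = 0\<close> like \<open>x\<^sub>k powr (a - 1)\<close>, and the \<open>p\<close>-th power of this is not
  integrable once \<open>(1 - a) * p \<ge> 1\<close>; because \<open>p > 1\<close>, some \<open>a\<close> in \<open>(0, 1)\<close> satisfies this with
  strict inequality. Let \<open>f1\<close> be \<open>(1 - \<bar>y\<bar>)\<^sup>2\<close> on the unit ball and \<open>0\<close> outside. Its gradient
  integral is positive, so with \<open>t = 1/2\<close> the right-hand side is \<open>\<infinity>\<close> (lemmas
  \<open>grad_integral_cusp\<close> and \<open>grad_integral_cone_square_pos\<close>).

  The left-hand side is finite (lemma \<open>grad_integral_sup_conv_cusp_cone_square\<close>). For \<open>t = 1/2\<close>
  the second factor \<open>f1 y powr (1/2) = max 0 (1 - \<bar>y\<bar>)\<close> is Lipschitz on the whole space, and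
  moving \<open>z\<close> while keeping \<open>x\<close> fixed moves only \<open>y\<close>. So the sup-convolution is a supremum of
  uniformly Lipschitz functions of \<open>z\<close>, however singular \<open>f0\<close> is. It also has bounded support,
  and a Lipschitz function with bounded support has a bounded gradient that vanishes outside a ball.

  Both functions are powers of a nonnegative concave function on a compact convex set, extended by
  \<open>0\<close>; lemma \<open>power_on_in_Q0\<close> shows that all such functions, except the zero function, lie in
  \<open>Q0\<close>.
\<close>

section \<open>Gradients and gradient integrals\<close>

lemma gradient_eqI:
  assumes "GDERIV g x :> D"
  shows "gradient g x = D"
proof -
  have "E = D" if "GDERIV g x :> E" for E
  proof -
    have "(\<lambda>h. h \<bullet> E) = (\<lambda>h. h \<bullet> D)"
      using that assms unfolding gderiv_def by (rule has_derivative_unique)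
    then have "\<forall>h. h \<bullet> E = h \<bullet> D"
      by (rule fun_cong[THEN allI])
    then show ?thesis
      by (simp add: vector_eq_ldot)
  qed
  then have "(THE E. GDERIV g x :> E) = D"
    using assms by (intro the_equality)
  then show ?thesis
    using assms by (auto simp: gradient_def)
qed

lemma GDERIV_transform_within_open:
  assumes "GDERIV f x :> D" "open S" "x \<in> S" "\<And>y. y \<in> S \<Longrightarrow> f y = g y"
  shows "GDERIV g x :> D"
  using assms unfolding gderiv_def by (rule has_derivative_transform_within_open)

text \<open>
  The difference quotients of \<open>g\<close> in the direction of its own gradient \<open>D\<close> converge to
  \<open>D \<bullet> D\<close>, and the Lipschitz bound keeps them below \<open>L * norm D\<close>. Where there is no gradient,
  the default value \<open>0\<close> satisfies the bound as well.
\<close>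

lemma norm_gradient_le_lipschitz:
  fixes g :: "'a::real_inner \<Rightarrow> real"
  assumes L: "L-lipschitz_on UNIV g"
  shows "norm (gradient g z) \<le> L"
proof (cases "\<exists>D. GDERIV g z :> D")
  case True
  then obtain D where D: "GDERIV g z :> D"
    by blast
  have L0: "0 \<le> L"
    using L by (rule lipschitz_on_nonneg)
  have "(g has_derivative (\<lambda>h. h \<bullet> D)) (at (z + 0 *\<^sub>R D))"
    using D by (simp add: gderiv_def)
  moreover have "((\<lambda>s::real. z + s *\<^sub>R D) has_derivative (\<lambda>s. s *\<^sub>R D)) (at 0)"
    by (auto intro!: derivative_eq_intros)
  ultimately have "((\<lambda>s. g (z + s *\<^sub>R D)) has_derivative (\<lambda>s. (s *\<^sub>R D) \<bullet> D)) (at 0)"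
    by (rule has_derivative_compose[rotated])
  then have "((\<lambda>s. g (z + s *\<^sub>R D)) has_real_derivative D \<bullet> D) (at 0)"
    by (simp add: has_field_derivative_def mult.commute[of _ "D \<bullet> D"] fun_eq_iff)
  then have lim: "((\<lambda>s. (g (z + s *\<^sub>R D) - g z) / s) \<longlongrightarrow> D \<bullet> D) (at 0)"
    by (simp add: DERIV_def)
  have "(g (z + s *\<^sub>R D) - g z) / s \<le> L * norm D" if "s \<noteq> 0" for s
  proof -
    have "\<bar>g (z + s *\<^sub>R D) - g z\<bar> \<le> L * (\<bar>s\<bar> * norm D)"
      using lipschitz_onD[OF L, of "z + s *\<^sub>R D" z] by (simp add: dist_norm)
    then have "\<bar>(g (z + s *\<^sub>R D) - g z) / s\<bar> \<le> L * norm D"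
      using that by (simp add: field_simps abs_divide)
    then show ?thesis
      by linarith
  qed
  then have "D \<bullet> D \<le> L * norm D"
    by (intro tendsto_upperbound[OF lim]) (auto simp: eventually_at_filter)
  then have "norm D * norm D \<le> L * norm D"
    by (simp add: power2_norm_eq_inner flip: power2_eq_square)
  then have "norm D \<le> L"
    using L0 by (cases "D = 0") auto
  then show ?thesis
    using gradient_eqI[OF D] by simp
next
  case False
  then show ?thesis
    using lipschitz_on_nonneg[OF L] by (simp add: gradient_def)
qed

text \<open>
  Beyond radius \<open>R\<close> the function is locally constant, so the integrand is at most \<open>L powr p\<close>
  times the indicator of a ball.
\<close>

lemma grad_integral_finite_if_lipschitz:
  fixes f :: "real ^ 'n::finite \<Rightarrow> ennreal"
  assumes L: "L-lipschitz_on UNIV (\<lambda>x. enn2real (f x))"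
    and supp: "\<And>x. norm x > R \<Longrightarrow> f x = 0" and p: "0 \<le> p"
  shows "grad_integral p f < \<infinity>"
proof -
  have "ennreal (norm (gradient (\<lambda>y. enn2real (f y)) x) powr p)
      \<le> ennreal (L powr p) * indicator (cball 0 R) x" for x
  proof (cases "norm x \<le> R")
    case True
    then show ?thesis
      using norm_gradient_le_lipschitz[OF L, of x] p
      by (auto intro!: ennreal_leI powr_mono2)
  next
    case False
    have "GDERIV (\<lambda>y. enn2real (f y)) x :> 0"
    proof (rule GDERIV_transform_within_open[OF GDERIV_const[of 0]])
      show "open (- cball (0 :: real ^ 'n) R)"
        by (simp add: open_Compl)
    qed (use False supp in auto)
    then show ?thesis
      by (simp add: gradient_eqI)
  qed
  then have "grad_integral p f \<le> (\<integral>\<^sup>+ x. ennreal (L powr p) * indicator (cball 0 R :: (real ^ 'n) set) x \<partial>lborel)"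
    unfolding grad_integral_def by (intro nn_integral_mono)
  also have "\<dots> = ennreal (L powr p) * emeasure lborel (cball 0 R :: (real ^ 'n) set)"
    by (simp add: nn_integral_cmult_indicator)
  also have "\<dots> < \<infinity>"
    using emeasure_lborel_cball_finite[of "0 :: real ^ 'n" R]
    by (simp add: ennreal_mult_less_top)
  finally show ?thesis .
qed

text \<open>
  The integrand is not known to be measurable, so a lower bound goes through a simple function
  below it.
\<close>

lemma grad_integral_ge:
  fixes f :: "real ^ 'n::finite \<Rightarrow> ennreal"
  assumes S: "S \<in> sets borel" and m: "0 \<le> m" and p: "0 \<le> p"
    and D: "\<And>x. x \<in> S \<Longrightarrow> GDERIV (\<lambda>y. enn2real (f y)) x :> D x"
    and mD: "\<And>x. x \<in> S \<Longrightarrow> m \<le> norm (D x)"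
  shows "ennreal (m powr p) * emeasure lborel S \<le> grad_integral p f"
proof -
  have "ennreal (m powr p) * emeasure lborel S = (\<integral>\<^sup>+ x. ennreal (m powr p) * indicator S x \<partial>lborel)"
    using S by (simp add: nn_integral_cmult_indicator)
  also have "\<dots> \<le> grad_integral p f"
    unfolding grad_integral_def
  proof (rule nn_integral_mono)
    fix x :: "real ^ 'n"
    show "ennreal (m powr p) * indicator S x \<le> ennreal (norm (gradient (\<lambda>y. enn2real (f y)) x) powr p)"
    proof (cases "x \<in> S")
      case True
      then have "m powr p \<le> norm (gradient (\<lambda>y. enn2real (f y)) x) powr p"
        using m p mD[OF True] gradient_eqI[OF D[OF True]] by (simp add: powr_mono2)
      then show ?thesis
        using True by (simp add: ennreal_leI)
    qed simp
  qed
  finally show ?thesis .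
qed

section \<open>Powers of concave functions on compact sets\<close>

definition power_on :: "'a set \<Rightarrow> ('a \<Rightarrow> real) \<Rightarrow> real \<Rightarrow> 'a \<Rightarrow> ennreal"
  where "power_on K h c x = (if x \<in> K then ennreal (h x powr c) else 0)"

lemma ennpowr_ennreal: "0 \<le> a \<Longrightarrow> ennreal a ennpowr r = ennreal (a powr r)"
  by (simp add: ennpowr_def)

lemma zero_ennpowr [simp]: "0 ennpowr r = 0"
  by (simp add: ennpowr_def)

text \<open>
  Concavity bounds \<open>h\<close> at the intermediate point below by an arithmetic mean, which by Young's
  inequality dominates the geometric mean; raising to the power \<open>c\<close> preserves this inequality
  and commutes with geometric means.
\<close>

lemma log_concave_power_on:
  assumes h: "concave_on K h" and nonneg: "\<And>x. x \<in> K \<Longrightarrow> 0 \<le> h x" and c: "0 \<le> c"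
  shows "log_concave_fun (power_on K h c)"
  unfolding log_concave_fun_def
proof (intro allI impI)
  fix l :: real and x y
  assume *: "0 < l \<and> l < 1 \<and> 0 < power_on K h c x * power_on K h c y"
  then have K: "x \<in> K" "y \<in> K" and l: "0 < l" "l < 1"
    by (auto simp: power_on_def split: if_splits)
  have pos: "0 < h x" "0 < h y"
    using * K nonneg[of x] nonneg[of y]
    by (auto simp: power_on_def less_le)
  let ?z = "(1 - l) *\<^sub>R x + l *\<^sub>R y"
  have z: "?z \<in> K"
    using concave_on_imp_convex[OF h] K l by (simp add: convex_def)
  have "h x powr (1 - l) * h y powr l \<le> (1 - l) * h x + l * h y"
    using l pos by (intro Youngs_inequality_0) auto
  also have "\<dots> \<le> h ?z"
    using concave_onD[OF h, of l x y] K l by simp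
  finally have "(h x powr (1 - l) * h y powr l) powr c \<le> h ?z powr c"
    using c by (intro powr_mono2) auto
  moreover have "(h x powr (1 - l) * h y powr l) powr c = (h x powr c) powr (1 - l) * (h y powr c) powr l"
    by (simp add: powr_mult powr_powr mult.commute)
  ultimately show "power_on K h c x ennpowr (1 - l) * power_on K h c y ennpowr l \<le> power_on K h c ?z"
    using K z by (simp add: power_on_def ennpowr_ennreal ennreal_leI flip: ennreal_mult)
qed

text \<open>
  On the closed set \<open>K\<close> the function is continuous, and extending by the least value \<open>0\<close> can only
  create downward jumps.
\<close>

lemma usc_power_on:
  fixes K :: "'a::t2_space set"
  assumes K: "closed K" and h: "continuous_on K h" and nonneg: "\<And>x. x \<in> K \<Longrightarrow> 0 \<le> h x"
    and c: "0 < c"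
  shows "usc_fun (power_on K h c)"
  unfolding usc_fun_def Limsup_le_iff
proof (intro allI impI)
  fix x y
  assume y: "power_on K h c x < y"
  show "\<forall>\<^sub>F x' in at x. power_on K h c x' < y"
  proof (cases "x \<in> K")
    case True
    have "continuous_on K (\<lambda>x. ennreal (h x powr c))"
      using h nonneg c
      by (intro continuous_on_ennreal continuous_on_powr' continuous_intros) auto
    then have "((\<lambda>x. ennreal (h x powr c)) \<longlongrightarrow> ennreal (h x powr c)) (at x within K)"
      using True by (simp add: continuous_on_def)
    then have "\<forall>\<^sub>F x' in at x within K. ennreal (h x' powr c) < y"
      using y True by (intro order_tendstoD) (auto simp: power_on_def)
    then show ?thesis
      unfolding eventually_at_filter
    proof eventually_elim
      case (elim x')
      have "0 < y"
        using y by (rule order.strict_trans1[rotated]) simp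
      with elim show ?case
        by (auto simp: power_on_def)
    qed
  next
    case False
    then have "\<forall>\<^sub>F x' in at x. x' \<in> - K"
      using K by (intro eventually_at_in_open') auto
    then show ?thesis
      by eventually_elim (use y False in \<open>auto simp: power_on_def\<close>)
  qed
qed

lemma power_on_in_Q0:
  fixes K :: "(real ^ 'n::finite) set"
  assumes K: "compact K" and concave: "concave_on K h" and cont: "continuous_on K h"
    and nonneg: "\<And>x. x \<in> K \<Longrightarrow> 0 \<le> h x" and pos: "x0 \<in> K" "0 < h x0" and c: "0 < c"
  shows "power_on K h c \<in> Q0"
proof -
  obtain R where R: "\<And>x. x \<in> K \<Longrightarrow> norm x \<le> R"
    using compact_imp_bounded[OF K] by (auto simp: bounded_iff)
  have "\<forall>\<^sub>F x in at_infinity. power_on K h c x = 0"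
    unfolding eventually_at_infinity
    by (rule exI[of _ "R + 1"]) (use R in \<open>force simp: power_on_def\<close>)
  then have "(power_on K h c \<longlongrightarrow> 0) at_infinity"
    by (rule tendsto_eventually)
  moreover have "power_on K h c x0 \<noteq> 0"
    using pos by (simp add: power_on_def)
  ultimately show ?thesis
    using log_concave_power_on[OF concave nonneg] usc_power_on[OF compact_imp_closed[OF K] cont nonneg c] c
    by (auto simp: Q0_def)
qed

lemma GDERIV_power_on:
  assumes h: "GDERIV h x :> D" and S: "open S" "S \<subseteq> K" "x \<in> S" and pos: "0 < h x"
  shows "GDERIV (\<lambda>y. enn2real (power_on K h c y)) x :> (c * h x powr (c - 1)) *\<^sub>R D"
proof (rule GDERIV_transform_within_open)
  show "GDERIV (\<lambda>y. h y powr c) x :> (c * h x powr (c - 1)) *\<^sub>R D"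
    using GDERIV_DERIV_compose[OF h has_real_derivative_powr[OF pos]] .
qed (use S in \<open>auto simp: power_on_def\<close>)

section \<open>Regularity of the sup-convolution\<close>

text \<open>
  Here one factor regularises the other. A decomposition \<open>(x, y)\<close> of \<open>z\<close> becomes a
  decomposition of \<open>w\<close> by keeping \<open>x\<close> and translating \<open>y\<close> by \<open>(w - z) / t\<close>. This changes the
  product by at most \<open>L / t * dist z w\<close>, because the factor at \<open>x\<close> is at most \<open>1\<close>. So the
  result does not inherit the singularities of \<open>f\<close>. The bounds by \<open>1\<close> also keep the supremum
  finite, so that \<open>enn2real\<close> does not truncate it.
\<close>

lemma sup_conv_lipschitz:
  fixes f g :: "'a::real_normed_vector \<Rightarrow> ennreal"
  assumes t: "0 < t" "t < 1" and L: "0 \<le> L"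
    and f1: "\<And>x. f x ennpowr (1 - t) \<le> 1"
    and g1: "\<And>y. g y ennpowr t \<le> 1"
    and gL: "\<And>y y'. g y ennpowr t \<le> g y' ennpowr t + ennreal (L * dist y y')"
  shows "(L / t)-lipschitz_on UNIV (\<lambda>z. enn2real (sup_conv t f g z))"
proof -
  have bound: "sup_conv t f g z \<le> 1" for z
    unfolding sup_conv_def
    by (rule Sup_least) (use mult_mono[OF f1 g1] in force)
  have le: "sup_conv t f g z \<le> sup_conv t f g w + ennreal (L / t * dist z w)" for z w
  proof -
    have "f x ennpowr (1 - t) * g y ennpowr t \<le> sup_conv t f g w + ennreal (L / t * dist z w)"
      if z: "(1 - t) *\<^sub>R x + t *\<^sub>R y = z" for x y
    proof -
      define y' where "y' = y + (1 / t) *\<^sub>R (w - z)"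
      have w: "(1 - t) *\<^sub>R x + t *\<^sub>R y' = w"
        using t z by (simp add: y'_def algebra_simps)
      have d: "L * dist y y' = L / t * dist z w"
      proof -
        have "dist y y' = norm ((1 / t) *\<^sub>R (w - z))"
          by (simp add: y'_def dist_norm del: norm_scaleR)
        then show ?thesis
          using t by (simp add: dist_norm norm_minus_commute)
      qed
      have "f x ennpowr (1 - t) * g y ennpowr t
          \<le> f x ennpowr (1 - t) * (g y' ennpowr t + ennreal (L / t * dist z w))"
        using gL[of y y'] unfolding d by (intro mult_left_mono) auto
      also have "\<dots> \<le> f x ennpowr (1 - t) * g y' ennpowr t + 1 * ennreal (L / t * dist z w)"
        unfolding distrib_left by (intro add_left_mono mult_right_mono f1) auto
      also have "f x ennpowr (1 - t) * g y' ennpowr t \<le> sup_conv t f g w"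
        unfolding sup_conv_def using w by (intro Sup_upper) blast
      finally show ?thesis
        by (simp add: add_right_mono)
    qed
    then show ?thesis
      unfolding sup_conv_def[of t f g z] by (intro Sup_least) blast
  qed
  have "enn2real (sup_conv t f g z) \<le> enn2real (sup_conv t f g w) + L / t * dist z w" for z w
  proof -
    have fin: "sup_conv t f g w < top"
      using bound[of w] by (rule order.strict_trans1) simp
    have "enn2real (sup_conv t f g z) \<le> enn2real (sup_conv t f g w + ennreal (L / t * dist z w))"
      using fin by (intro enn2real_mono le) auto
    also have "\<dots> = enn2real (sup_conv t f g w) + L / t * dist z w"
      using fin t L by (subst enn2real_plus) auto
    finally show ?thesis .
  qed
  then have "\<bar>enn2real (sup_conv t f g z) - enn2real (sup_conv t f g w)\<bar> \<le> L / t * dist z w" for z w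
    by (metis abs_le_iff add.commute diff_le_eq dist_commute minus_diff_eq)
  then show ?thesis
    using t L by (intro lipschitz_onI) (auto simp: dist_real_def)
qed

text \<open>
  A point of norm greater than \<open>(1 - t) * A + t * B\<close> has no decomposition into a point of norm at
  most \<open>A\<close> and one of norm at most \<open>B\<close>.
\<close>

lemma sup_conv_eq_0:
  fixes f g :: "'a::real_normed_vector \<Rightarrow> ennreal"
  assumes t: "0 < t" "t < 1"
    and f: "\<And>x. norm x > A \<Longrightarrow> f x = 0" and g: "\<And>y. norm y > B \<Longrightarrow> g y = 0"
    and z: "norm z > (1 - t) * A + t * B"
  shows "sup_conv t f g z = 0"
proof -
  have "f x ennpowr (1 - t) * g y ennpowr t = 0" if "(1 - t) *\<^sub>R x + t *\<^sub>R y = z" for x y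
  proof -
    have "norm z \<le> (1 - t) * norm x + t * norm y"
      using norm_triangle_ineq[of "(1 - t) *\<^sub>R x" "t *\<^sub>R y"] t that by simp
    then have "norm x > A \<or> norm y > B"
      using z t mult_left_mono[of "norm x" A "1 - t"] mult_left_mono[of "norm y" B t] by linarith
    then show ?thesis
      using f g by auto
  qed
  then have "sup_conv t f g z \<le> 0"
    unfolding sup_conv_def by (intro Sup_least) auto
  then show ?thesis
    by simp
qed

section \<open>The two functions of the counterexample\<close>

definition cusp :: "'n \<Rightarrow> real \<Rightarrow> real ^ 'n \<Rightarrow> ennreal"
  where "cusp k a = power_on (cbox 0 1) (\<lambda>x. x $ k) a"

text \<open>
  The exponent \<open>2\<close> is the reciprocal of \<open>t = 1/2\<close>: in the sup-convolution the function enters as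
  its square root, which is the Lipschitz function \<open>max 0 (1 - \<bar>y\<bar>)\<close>.
\<close>

definition cone_square :: "'a::real_normed_vector \<Rightarrow> ennreal"
  where "cone_square = power_on (cball 0 1) (\<lambda>y. 1 - norm y) 2"

lemma cusp_in_Q0:
  fixes k :: "'n::finite"
  assumes "0 < a"
  shows "cusp k a \<in> Q0"
  unfolding cusp_def
proof (rule power_on_in_Q0)
  show "concave_on (cbox 0 1) (\<lambda>x::real ^ 'n. x $ k)"
    by (simp add: concave_on_iff)
  show "(1 :: real ^ 'n) \<in> cbox 0 1"
    by (simp add: mem_box_cart)
qed (use assms in \<open>auto simp: mem_box_cart intro!: continuous_intros\<close>)

lemma cone_square_in_Q0:
  shows "cone_square \<in> (Q0 :: (real ^ 'n::finite \<Rightarrow> ennreal) set)"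
  unfolding cone_square_def
proof (rule power_on_in_Q0)
  show "concave_on (cball 0 1) (\<lambda>y::real ^ 'n. 1 - norm y)"
    unfolding concave_on_iff
  proof (intro conjI ballI allI impI)
    fix x y :: "real ^ 'n" and u v :: real
    assume uv: "0 \<le> u" "0 \<le> v" "u + v = 1"
    have "norm (u *\<^sub>R x + v *\<^sub>R y) \<le> u * norm x + v * norm y"
      using norm_triangle_ineq[of "u *\<^sub>R x" "v *\<^sub>R y"] uv by simp
    moreover have "u * (1 - norm x) + v * (1 - norm y) = 1 - (u * norm x + v * norm y)"
      using uv(3) by (simp add: algebra_simps)
    ultimately show "u * (1 - norm x) + v * (1 - norm y) \<le> 1 - norm (u *\<^sub>R x + v *\<^sub>R y)"
      by simp
  qed simp
  show "(0 :: real ^ 'n) \<in> cball 0 1"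
    by simp
qed (auto intro!: continuous_intros)

lemma emeasure_slab:
  fixes k :: "'n::finite"
  assumes "0 \<le> e"
  shows "emeasure lborel (box 0 (\<chi> i. if i = k then e else 1) :: (real ^ 'n) set) = ennreal e"
proof -
  let ?u = "(\<chi> i. if i = k then e else 1) :: real ^ 'n"
  have "cbox 0 ?u \<noteq> {}"
    using assms by (auto simp: interval_ne_empty_cart)
  then have "measure lborel (cbox 0 ?u) = e"
    by (simp add: content_cbox_cart)
  then have "measure lborel (box 0 ?u) = e"
    by (simp add: measure_lborel_box_eq measure_lborel_cbox_eq)
  then show ?thesis
    using emeasure_lborel_box_finite[of 0 ?u] by (simp add: emeasure_eq_ennreal_measure)
qed

lemma GDERIV_component: "GDERIV (\<lambda>x. x $ k) x :> axis k (1::real)"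
  unfolding gderiv_def
  by (simp add: inner_axis) (rule bounded_linear_imp_has_derivative[OF bounded_linear_vec_nth])

text \<open>
  On the slab \<open>0 < x\<^sub>k < e\<close> of the cube, whose volume is \<open>e\<close>, the gradient has norm at least
  \<open>a * e powr (a - 1)\<close>. So this slab alone contributes at least \<open>a powr p * e powr (- d)\<close> with
  \<open>d = (1 - a) * p - 1 > 0\<close>, which is unbounded as \<open>e\<close> tends to \<open>0\<close>.
\<close>

lemma grad_integral_cusp:
  fixes k :: "'n::finite"
  assumes a: "0 < a" "a < 1" and ap: "(1 - a) * p > 1"
  shows "grad_integral p (cusp k a) = \<infinity>"
proof (rule ccontr)
  have p: "0 < p"
    using a ap by (smt (verit) mult_nonneg_nonpos)
  define d where "d = (1 - a) * p - 1"
  have d: "0 < d"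
    using ap by (simp add: d_def)
  have lower: "ennreal (a powr p * e powr (- d)) \<le> grad_integral p (cusp k a)" if e: "0 < e" "e < 1" for e
  proof -
    let ?S = "box 0 (\<chi> i. if i = k then e else 1) :: (real ^ 'n) set"
    let ?D = "\<lambda>x :: real ^ 'n. (a * x $ k powr (a - 1)) *\<^sub>R axis k (1::real)"
    have sub: "?S \<subseteq> cbox 0 1"
    proof
      fix x assume "x \<in> ?S"
      then have x: "0 < x $ i" "x $ i < (if i = k then e else 1)" for i
        by (simp_all add: mem_box_cart)
      have "x $ i \<le> 1" for i
        using x(2)[of i] e by (cases "i = k") auto
      then show "x \<in> cbox 0 1"
        using x(1) by (simp add: mem_box_cart less_imp_le)
    qed
    have xk: "0 < x $ k" "x $ k < e" if "x \<in> ?S" for x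
      using that by (auto simp: mem_box_cart dest: spec[of _ k])
    have "ennreal ((a * e powr (a - 1)) powr p) * emeasure lborel ?S \<le> grad_integral p (cusp k a)"
    proof (rule grad_integral_ge)
      fix x assume x: "x \<in> ?S"
      show "GDERIV (\<lambda>y. enn2real (cusp k a y)) x :> ?D x"
        unfolding cusp_def using x sub xk[OF x]
        by (intro GDERIV_power_on[where S = ?S] GDERIV_component) auto
      have "e powr (a - 1) \<le> x $ k powr (a - 1)"
        using a xk[OF x] by (intro powr_mono2') auto
      then show "a * e powr (a - 1) \<le> norm (?D x)"
        using a by (simp add: abs_mult)
    qed (use a p in auto)
    also have "ennreal ((a * e powr (a - 1)) powr p) * emeasure lborel ?S
        = ennreal (a powr p * (e powr ((a - 1) * p) * e powr 1))"
      using a e by (simp add: emeasure_slab powr_mult powr_powr mult.assoc flip: ennreal_mult)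
    also have "e powr ((a - 1) * p) * e powr 1 = e powr (- d)"
      unfolding powr_add[symmetric] by (simp add: d_def algebra_simps)
    finally show ?thesis .
  qed
  assume "grad_integral p (cusp k a) \<noteq> \<infinity>"
  then obtain r where r: "0 \<le> r" "grad_integral p (cusp k a) = ennreal r"
    by (cases "grad_integral p (cusp k a)") auto
  \<comment> \<open>\<open>w\<close> is the value of \<open>e powr (- d)\<close> to aim at: it makes the lower bound exceed \<open>r\<close>, and
    \<open>w > 1\<close> ensures that the corresponding \<open>e\<close> is less than \<open>1\<close>.\<close>
  define w where "w = 2 + r / a powr p"
  have w: "w > 1"
    using r by (simp add: w_def add_pos_nonneg add_strict_increasing2 less_le_trans[of 1 2])
  define e where "e = w powr (- (1 / d))"
  have "e < 1"
    using w d by (simp add: e_def powr_less_one)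
  moreover have "0 < e"
    using w by (simp add: e_def)
  ultimately have "ennreal (a powr p * e powr (- d)) \<le> ennreal r"
    using lower r by metis
  then have "a powr p * e powr (- d) \<le> r"
    using r by simp
  moreover have "e powr (- d) = w"
    using d w by (simp add: e_def powr_powr)
  moreover have "a powr p * w = 2 * a powr p + r"
    using a by (simp add: w_def field_simps)
  ultimately show False
    using a by simp
qed

text \<open>
  At distance less than \<open>1/2\<close> from the origin, the origin itself excepted, the gradient has norm
  \<open>2 * (1 - norm y) \<ge> 1\<close>.
\<close>

lemma grad_integral_cone_square_pos:
  assumes p: "0 \<le> p"
  shows "0 < grad_integral p (cone_square :: real ^ 'n::finite \<Rightarrow> ennreal)"
proof -
  let ?S = "ball 0 (1/2) - {0} :: (real ^ 'n) set"
  let ?D = "\<lambda>y :: real ^ 'n. (2 * (1 - norm y) powr (2 - 1)) *\<^sub>R (0 - sgn y)"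
  have "ennreal (1 powr p) * emeasure lborel ?S \<le> grad_integral p (cone_square :: real ^ 'n \<Rightarrow> ennreal)"
  proof (rule grad_integral_ge)
    fix y assume y: "y \<in> ?S"
    show "GDERIV (\<lambda>y. enn2real (cone_square y)) y :> ?D y"
      unfolding cone_square_def using y
      by (intro GDERIV_power_on[where S = ?S] GDERIV_diff GDERIV_const GDERIV_norm) auto
    show "1 \<le> norm (?D y)"
      using y by (simp add: norm_sgn)
  qed (use p in auto)
  moreover have "emeasure lborel ?S = emeasure lborel (ball 0 (1/2) :: (real ^ 'n) set)"
    by (rule emeasure_Diff_null_set) (auto simp: null_sets_def)
  moreover have "0 < emeasure lborel (ball 0 (1/2) :: (real ^ 'n) set)"
    using content_ball_pos[of "1/2" "0 :: real ^ 'n"] by (auto simp: measure_def zero_less_iff_neq_zero)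
  ultimately show ?thesis
    by (simp add: order.strict_trans2)
qed

lemma cone_square_ennpowr_half: "cone_square y ennpowr (1/2) = ennreal (max 0 (1 - norm y))"
  by (auto simp: cone_square_def power_on_def ennpowr_ennreal powr_powr ennreal_neg)

text \<open>
  The cusp contributes only its bound \<open>1\<close> and its bounded support; the Lipschitz constant comes
  from the cone alone.
\<close>

lemma grad_integral_sup_conv_cusp_cone_square:
  fixes k :: "'n::finite"
  assumes a: "0 < a" and p: "0 \<le> p"
  shows "grad_integral p (sup_conv (1/2) (cusp k a) cone_square) < \<infinity>"
proof -
  obtain R where R: "\<And>x. x \<in> cbox 0 (1 :: real ^ 'n) \<Longrightarrow> norm x \<le> R"
    using bounded_cbox[of 0 "1 :: real ^ 'n"] unfolding bounded_iff by blast
  show ?thesis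
  proof (rule grad_integral_finite_if_lipschitz)
    show "(1 / (1/2))-lipschitz_on UNIV (\<lambda>z. enn2real (sup_conv (1/2) (cusp k a) cone_square z))"
    proof (rule sup_conv_lipschitz)
      fix x :: "real ^ 'n"
      show "cusp k a x ennpowr (1 - 1/2) \<le> 1"
        using a by (auto simp: cusp_def power_on_def mem_box_cart ennpowr_ennreal powr_powr powr_le1)
    next
      fix y y' :: "real ^ 'n"
      show "cone_square y ennpowr (1/2) \<le> 1"
        by (simp add: cone_square_ennpowr_half)
      have "max 0 (1 - norm y) \<le> max 0 (1 - norm y') + 1 * dist y y'"
        using norm_triangle_ineq2[of y' y] by (simp add: dist_norm norm_minus_commute)
      then show "cone_square y ennpowr (1/2) \<le> cone_square y' ennpowr (1/2) + ennreal (1 * dist y y')"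
        by (simp add: cone_square_ennpowr_half ennreal_leI flip: ennreal_plus)
    qed auto
    show "sup_conv (1/2) (cusp k a) cone_square z = 0" if "norm z > (1 - 1/2) * R + 1/2 * 1" for z
      using that
    proof (rule sup_conv_eq_0[rotated 4])
      show "cusp k a x = 0" if "norm x > R" for x
        using that R[of x] by (auto simp: cusp_def power_on_def)
    qed (auto simp: cone_square_def power_on_def)
  qed (rule p)
qed

theorem corollary4p12:
  fixes p :: real
  assumes "CARD('n::finite) \<ge> 2" and "p > 1"
  shows "\<exists>f0 \<in> (Q0 :: (real ^ 'n \<Rightarrow> ennreal) set). \<exists>f1 \<in> (Q0 :: (real ^ 'n \<Rightarrow> ennreal) set).
           \<exists>t::real. 0 < t \<and> t < 1 \<and>
             grad_integral p (sup_conv t f0 f1)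
               < grad_integral p f0 ennpowr (1 - t) * grad_integral p f1 ennpowr t"
proof -
  fix k :: 'n
  \<comment> \<open>This exponent gives \<open>(1 - a) * p = (p + 1) / 2\<close>, halfway between \<open>1\<close> and \<open>p\<close>.\<close>
  define a where "a = (p - 1) / (2 * p)"
  have a: "0 < a" "a < 1" and ap: "(1 - a) * p > 1"
    using assms(2) by (auto simp: a_def field_simps)
  have "grad_integral p (cone_square :: real ^ 'n \<Rightarrow> ennreal) \<noteq> 0"
    using grad_integral_cone_square_pos[of p, where 'n = 'n] assms(2) by simp
  then have "grad_integral p (cone_square :: real ^ 'n \<Rightarrow> ennreal) ennpowr (1/2) \<noteq> 0"
    by (cases "grad_integral p (cone_square :: real ^ 'n \<Rightarrow> ennreal)") (auto simp: ennpowr_def)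
  then have "grad_integral p (cusp k a) ennpowr (1 - 1/2)
      * grad_integral p (cone_square :: real ^ 'n \<Rightarrow> ennreal) ennpowr (1/2) = \<infinity>"
    unfolding grad_integral_cusp[OF a ap] by (simp add: ennpowr_def)
  moreover have "grad_integral p (sup_conv (1/2) (cusp k a) cone_square) < \<infinity>"
    using a assms(2) by (intro grad_integral_sup_conv_cusp_cone_square) auto
  ultimately have "grad_integral p (sup_conv (1/2) (cusp k a) cone_square)
      < grad_integral p (cusp k a) ennpowr (1 - 1/2)
        * grad_integral p (cone_square :: real ^ 'n \<Rightarrow> ennreal) ennpowr (1/2)"
    by simp
  then show ?thesis
    using cusp_in_Q0[OF a(1), of k] cone_square_in_Q0
    by (intro bexI[of _ "cusp k a"] bexI[of _ cone_square] exI[of _ "1/2"]) auto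
qed

end
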